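(* Let $s$ be a node of a branch-and-bound tree for the biobjective mixed-integer linear program of minimizing $\boldsymbol f(x)=(f_1(x),f_2(x))$ over $X_I$, with all node-related objects as defined in the context. Node $s$ can be fathomed if any of the following holds: (0) $\mathcal{ND}(Y_s)\subset (Y_s)_I$; (1a) $\mathcal U_s\succ\mathcal P_s$; (2a) $\mathcal U_s\succ H^\lambda_s$; (1b) $\mathcal U_s\succ D^{\mathcal I}_s$ for some $\mathcal I\subset\{1,2,\lambda\}$; (2b) $\mathcal U_s\succ\tilde H^\lambda_s$; (3) $\mathcal L_s\subseteq\mathcal U_s$. Here "node $s$ can be fathomed" means, for rule (0), fathoming by optimality: $\mathcal{ND}((Y_s)_I)=\mathcal{ND}(Y_s)$, i.e. the linear relaxation at $s$ already yields all nondominated points of the node's mixed-integer problem; and for the remaining rules, fathoming by bound dominance: $\mathcal U_s\succ (Y_s)_I$, i.e. every point of $(Y_s)_I$ is dominated by a point of the current primal bound set.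
   Context: Problem. Let $X=\{x\in\mathbb R^{n+p}_{+} : Ax\le b,\ l_i\le x_i\le u_i\ \forall i\}$ and $X_I=X\cap(\mathbb Z^n\times\mathbb R^p)$, with $A$ a real matrix, $b$ a real vector, $X_I\ne\emptyset$ and $-\infty<l_i<u_i<+\infty$ for all $i$. Objectives: $f_k(x)=(c^k)^{\mathsf T}x$, $k=1,2$, and $\boldsymbol f=(f_1,f_2)$. Dominance. For $y,y'\in\mathbb R^2$, $y\succ y'$ ($y$ dominates $y'$) if $y\le y'$ componentwise, equivalently $y'\in y+\mathbb R^2_{\ge0}$, where $\mathbb R^2_{\ge 0}$ is the nonnegative orthant. For sets $S,S'\subseteq\mathbb R^2$, $S\succ S'$ means that for every $y'\in S'$ there is $y\in S$ with $y\succ y'$. For $S\subseteq\mathbb R^2$, $\mathcal{ND}(S)=\{y\in S : \nexists\,y'\in S,\ y'\neq y,\ y'\succ y\}$. The ideal point $S^{ideal}$ of a nonempty compact $S$ is the point whose $k$-th coordinate is $\min_{y\in S}y_k$, $k=1,2$ (also identified with the singleton containing it). Node data. At node $s$, $X_s\subseteq X$ is a polytope (the relaxed feasible set of the node) and $(X_s)_I=X_s\cap(\mathbb Z^n\times\mathbb R^p)$ is the mixed-integer feasible set of the node, assumed nonempty. Put $Y_s=\boldsymbol f(X_s)$ and $(Y_s)_I=\boldsymbol f((X_s)_I)$. The local dual bound set is $\mathcal L_s=\mathcal{ND}(Y_s)+\mathbb R^2_{\ge0}$. Primal bound. Let $T_s\subset\mathbb Z^n_+$ be the finite set of (integer parts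 of) integer feasible solutions found so far; for $\tilde x\in T_s$ let $X(\tilde x)=\{x\in X : x_i=\tilde x_i,\ i=1,\dots,n\}$ (nonempty). Then $\mathcal N_s=\mathcal{ND}\big(\bigcup_{\tilde x\in T_s}\mathcal{ND}(\boldsymbol f(X(\tilde x)))\big)$ and $\mathcal U_s=\mathcal N_s+\mathbb R^2_{\ge0}$. Special points. For $k\in\{1,2\}$ and $i\in\{1,2\}\setminus\{k\}$, $y^k_s$ is the lexicographic minimum over $X_s$ given by $(y^k_s)_i=f_i^*:=\min_{x\in X_s}f_i(x)$ and $(y^k_s)_k=\min\{f_k(x) : x\in X_s,\ f_i(x)=f_i^*\}$; $(y^k_s)_I$ is defined in the same way with $(X_s)_I$ in place of $X_s$. Assume $y^1_s\ne y^2_s$, and let $H_s$ be the line segment joining $y^1_s$ and $y^2_s$. Let $\lambda\in(0,1)$ be such that $\lambda^s=(1-\lambda,\lambda)$ is a normal vector of $H_s$, and let $f_\lambda=(1-\lambda)f_1+\lambda f_2$. Let $y^\lambda_s=\boldsymbol f(\bar x)$ for a minimizer $\bar x$ of $f_\lambda$ over $X_s$, and $(y^\lambda_s)_I=\boldsymbol f(\hat x)$ for a minimizer $\hat x$ of $f_\lambda$ over $(X_s)_I$. Bounding sets. For $k\in\{1,2\}$, $\mathcal P^k_s=\{y^i_s : i\in\{1,2\},\ i\neq k\}\cup\{y^\lambda_s\}$, and $\mathcal P_s=(\mathcal P^1_s)^{ideal}\cup(\mathcal P^2_s)^{ideal}$ (a set of at most two points). For $\mathcal I\subset\{1,2,\lambda\}$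 (any subset), $$D^{\mathcal I}_s=\bigcup_{k=1}^2\Big(\{y^i_s : i\in\{1,2,\lambda\}\setminus\{k\},\ i\notin\mathcal I\}\cup\{(y^i_s)_I : i\in\mathcal I\setminus\{k\}\}\Big)^{ideal}.$$ $H^\lambda_s$ is the intersection of $(Y_s)^{ideal}+\mathbb R^2_{\ge0}$ with the line through $y^\lambda_s$ with normal vector $\lambda^s$. $\tilde H^\lambda_s$ is the intersection of $((Y_s)_I)^{ideal}+\mathbb R^2_{\ge0}$ with the line through $(y^\lambda_s)_I$ with normal vector $\lambda^s$. *)

theory Defs
  imports "HOL-Analysis.Analysis" "HOL-Library.Set_Algebras"
begin

text \<open>
  Decision vectors live in \<^typ>\<open>real ^ 'd\<close>; the set \<open>J\<close> of integer-constrained coordinates is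
  arbitrary, so that \<open>n = card J\<close> and \<open>p = CARD('d) - n\<close>, and either may be zero.
  Objective vectors live in \<^typ>\<open>real ^ 2\<close>, whose order is componentwise.
  In the index type \<^typ>\<open>2\<close> the two elements are written \<open>1\<close> and \<open>2\<close> (where \<open>2 = 0\<close>).
\<close>

definition feasible_set ::
    "real ^ 'd ^ 'm \<Rightarrow> real ^ 'm \<Rightarrow> real ^ 'd \<Rightarrow> real ^ 'd \<Rightarrow> (real ^ 'd) set" where
  "feasible_set A b l u =
     {x. (\<forall>i. 0 \<le> x $ i) \<and> A *v x \<le> b \<and> (\<forall>i. l $ i \<le> x $ i \<and> x $ i \<le> u $ i)}"

definition mixed_integer :: "'d set \<Rightarrow> (real ^ 'd) set" where
  "mixed_integer J = {x. \<forall>i\<in>J. x $ i \<in> \<int>}"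

definition objective :: "(2 \<Rightarrow> real ^ 'd) \<Rightarrow> real ^ 'd \<Rightarrow> real ^ 2" where
  "objective c x = (\<chi> k. c k \<bullet> x)"

definition dominates :: "real ^ 2 \<Rightarrow> real ^ 2 \<Rightarrow> bool" where
  "dominates y y' \<longleftrightarrow> y \<le> y'"

definition set_dominates :: "(real ^ 2) set \<Rightarrow> (real ^ 2) set \<Rightarrow> bool" where
  "set_dominates S S' \<longleftrightarrow> (\<forall>y'\<in>S'. \<exists>y\<in>S. dominates y y')"

definition ND :: "(real ^ 2) set \<Rightarrow> (real ^ 2) set" where
  "ND S = {y \<in> S. \<not> (\<exists>y'\<in>S. y' \<noteq> y \<and> dominates y' y)}"

definition nonneg_orthant :: "(real ^ 2) set" where
  "nonneg_orthant = {y. \<forall>k. 0 \<le> y $ k}"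

text \<open>The minimum of \<open>g\<close> over \<open>S\<close>; unspecified if it is not attained.\<close>

definition min_over :: "('a \<Rightarrow> real) \<Rightarrow> 'a set \<Rightarrow> real" where
  "min_over g S = (LEAST v. v \<in> g ` S)"

definition ideal_point :: "(real ^ 2) set \<Rightarrow> real ^ 2" where
  "ideal_point S = (\<chi> k. min_over (\<lambda>y. y $ k) S)"

definition other :: "2 \<Rightarrow> 2" where
  "other k = (if k = 1 then 2 else 1)"

text \<open>Beware of the convention: the point with index \<open>k\<close> minimizes the \<^emph>\<open>other\<close> objective first.\<close>

definition lex_min :: "(real ^ 'd \<Rightarrow> real ^ 2) \<Rightarrow> (real ^ 'd) set \<Rightarrow> 2 \<Rightarrow> real ^ 2" where
  "lex_min f S k =
     (let i = other k; m = min_over (\<lambda>x. f x $ i) S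
      in \<chi> j. if j = i then m else min_over (\<lambda>x. f x $ k) {x \<in> S. f x $ i = m})"

definition weight_vec :: "real \<Rightarrow> real ^ 2" where
  "weight_vec lam = vector [1 - lam, lam]"

definition weighted_objective :: "(real ^ 'd \<Rightarrow> real ^ 2) \<Rightarrow> real \<Rightarrow> real ^ 'd \<Rightarrow> real" where
  "weighted_objective f lam x = (1 - lam) * f x $ 1 + lam * f x $ 2"

definition normal_vector_of :: "real ^ 2 \<Rightarrow> (real ^ 2) set \<Rightarrow> bool" where
  "normal_vector_of v H \<longleftrightarrow> v \<noteq> 0 \<and> (\<forall>y\<in>H. \<forall>z\<in>H. orthogonal v (y - z))"

definition line_with_normal :: "real ^ 2 \<Rightarrow> real ^ 2 \<Rightarrow> (real ^ 2) set" where
  "line_with_normal v y = {z. orthogonal v (z - y)}"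

text \<open>
  \<open>fibre X J t\<close> is the set of points of \<open>X\<close> with integer part \<open>t\<close>. Integer parts, i.e. elements of
  the \<open>n\<close>-fold power of the nonnegative integers, are extensional functions on \<open>J\<close>.
\<close>

definition fibre :: "(real ^ 'd) set \<Rightarrow> 'd set \<Rightarrow> ('d \<Rightarrow> nat) \<Rightarrow> (real ^ 'd) set" where
  "fibre X J t = {x \<in> X. \<forall>i\<in>J. x $ i = real (t i)}"

definition primal_points ::
    "(real ^ 'd \<Rightarrow> real ^ 2) \<Rightarrow> (real ^ 'd) set \<Rightarrow> 'd set \<Rightarrow> ('d \<Rightarrow> nat) set \<Rightarrow> (real ^ 2) set" where
  "primal_points f X J T = ND (\<Union>t\<in>T. ND (f ` fibre X J t))"

text \<open>The index set \<open>{1, 2, \<lambda>}\<close>.\<close>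

datatype bound_index = Obj 2 | Lam

definition special_point ::
    "(real ^ 'd \<Rightarrow> real ^ 2) \<Rightarrow> (real ^ 'd) set \<Rightarrow> real ^ 'd \<Rightarrow> bound_index \<Rightarrow> real ^ 2" where
  "special_point f S x i = (case i of Obj k \<Rightarrow> lex_min f S k | Lam \<Rightarrow> f x)"

definition ideal_bound_set :: "(bound_index \<Rightarrow> real ^ 2) \<Rightarrow> (real ^ 2) set" where
  "ideal_bound_set y = (\<Union>k. {ideal_point ({y (Obj i) |i. i \<noteq> k} \<union> {y Lam})})"

text \<open>\<open>y\<close> collects the relaxed and \<open>yI\<close> the mixed-integer special points.\<close>

definition mixed_bound_set ::
    "(bound_index \<Rightarrow> real ^ 2) \<Rightarrow> (bound_index \<Rightarrow> real ^ 2) \<Rightarrow> bound_index set \<Rightarrow> (real ^ 2) set"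
  where
  "mixed_bound_set y yI I =
     (\<Union>k. {ideal_point ({y i |i. i \<in> UNIV - {Obj k} \<and> i \<notin> I} \<union> {yI i |i. i \<in> I - {Obj k}})})"

definition line_bound_set :: "real \<Rightarrow> (real ^ 2) set \<Rightarrow> real ^ 2 \<Rightarrow> (real ^ 2) set" where
  "line_bound_set lam Y y =
     ({ideal_point Y} + nonneg_orthant) \<inter> line_with_normal (weight_vec lam) y"

end

theory Submission
  imports Defs
begin

text \<open>
  Dominance is transitive, so it suffices that every point of the (relaxed or mixed-integer)
  image is dominated by a point of the bound set in question. For \<open>ND\<close> this is
  compactness. For the ideal points, a point \<open>z\<close> of the image cannot be strictly below the
  minimizer of the weighted objective in both coordinates; if it is not below in coordinate
  \<open>other k\<close>, the ideal point with index \<open>k\<close> dominates it. For the line, the segment from the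
  ideal point to \<open>z\<close> crosses it, because the weighted objective grows from at most to at least
  its minimum along the segment.
\<close>

lemma other_simps [simp]: "other 1 = 2" "other 2 = 1"
  by (auto simp: other_def)

lemma mem_plus_orthant_iff: "z \<in> N + nonneg_orthant \<longleftrightarrow> (\<exists>y\<in>N. y \<le> z)"
proof
  assume "z \<in> N + nonneg_orthant"
  then obtain a e where "z = a + e" "a \<in> N" "e \<in> nonneg_orthant"
    by (auto elim: set_plus_elim)
  then show "\<exists>y\<in>N. y \<le> z"
    by (intro bexI[of _ a]) (auto simp: nonneg_orthant_def less_eq_vec_def)
next
  assume "\<exists>y\<in>N. y \<le> z"
  then obtain y where y: "y \<in> N" "y \<le> z" by blast
  then have "z - y \<in> nonneg_orthant"
    by (simp add: nonneg_orthant_def less_eq_vec_def)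
  from set_plus_intro[OF y(1) this] show "z \<in> N + nonneg_orthant" by simp
qed

lemma set_dominates_trans:
  assumes "set_dominates S S'" "set_dominates S' S''"
  shows "set_dominates S S''"
  using assms unfolding set_dominates_def dominates_def by (meson order_trans)

text \<open>On the reals \<open>LEAST\<close> denotes a minimum only when one is attained;
  compactness of the image guarantees this.\<close>

lemma min_over_le:
  assumes "compact (g ` S)" "x \<in> S"
  shows "min_over g S \<le> g x"
proof -
  obtain m where m: "m \<in> g ` S" "\<And>t. t \<in> g ` S \<Longrightarrow> m \<le> t"
    using compact_attains_inf[OF assms(1)] assms(2) by blast
  then have "min_over g S = m"
    unfolding min_over_def by (intro Least_equality) auto
  then show ?thesis using m assms(2) by auto
qed

lemma ideal_point_le:
  assumes "compact S" "y \<in> S"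
  shows "ideal_point S $ k \<le> y $ k"
proof -
  have "compact ((\<lambda>y. y $ k) ` S)"
    using assms(1) by (intro compact_continuous_image continuous_intros)
  then show ?thesis
    using min_over_le assms(2) by (fastforce simp: ideal_point_def)
qed

text \<open>The first stage of the lexicographic minimization already fixes coordinate
  \<open>other k\<close> as a minimum over \<open>S\<close>.\<close>

lemma lex_min_other_le:
  assumes "compact (f ` S)" "x \<in> S"
  shows "lex_min f S k $ other k \<le> f x $ other k"
proof -
  have "compact ((\<lambda>y. y $ other k) ` (f ` S))"
    by (intro compact_continuous_image[OF _ assms(1)] continuous_intros)
  then have "compact ((\<lambda>x. f x $ other k) ` S)"
    by (simp add: image_image)
  from min_over_le[OF this assms(2)] show ?thesis
    by (simp add: lex_min_def Let_def)
qed

text \<open>The part of \<open>S\<close> below \<open>z\<close> is compact, so the coordinate sum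
  has a minimizer there. Such a minimizer is nondominated in all of \<open>S\<close>.\<close>

lemma ND_externally_stable:
  assumes "compact S"
  shows "set_dominates (ND S) S"
  unfolding set_dominates_def dominates_def
proof
  fix z assume z: "z \<in> S"
  define K where "K = S \<inter> {y. y \<le> z}"
  have "{y. y \<le> z} = (\<Inter>i. {y::real^2. y $ i \<le> z $ i})"
    by (auto simp: less_eq_vec_def)
  moreover have "closed (\<Inter>i. {y::real^2. y $ i \<le> z $ i})"
    by (intro closed_INT ballI closed_Collect_le continuous_intros)
  ultimately have "compact K"
    unfolding K_def using assms by (metis compact_Int_closed)
  moreover have "z \<in> K" using z by (simp add: K_def)
  moreover have "continuous_on K (\<lambda>y. y $ 1 + y $ 2)"
    by (intro continuous_intros)
  ultimately obtain m where m: "m \<in> K" "\<And>y. y \<in> K \<Longrightarrow> m $ 1 + m $ 2 \<le> y $ 1 + y $ 2"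
    using continuous_attains_inf[of K "\<lambda>y. y $ 1 + y $ 2"] by blast
  \<comment> \<open>Anything below \<open>m\<close> is below \<open>z\<close>, hence in
    \<open>K\<close>, and its coordinate sum is at least that of \<open>m\<close>. Being
    componentwise smaller, it must coincide with \<open>m\<close>.\<close>
  have "y' = m" if "y' \<in> S" "y' \<le> m" for y'
  proof -
    have "y' \<in> K" using that m(1) by (auto simp: K_def)
    from m(2)[OF this] that(2) show ?thesis
      by (simp add: less_eq_vec_def vec_eq_iff forall_2)
  qed
  then have "m \<in> ND S" using m(1) by (auto simp: ND_def dominates_def K_def)
  then show "\<exists>y\<in>ND S. y \<le> z" using m(1) by (auto simp: K_def)
qed

text \<open>Shrinking a set creates no new dominators, which gives one inclusion. For the other,
  external stability yields a dominator in \<open>ND Y\<close>; it lies in \<open>Z\<close>, so it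
  equals the given nondominated point of \<open>Z\<close>.\<close>

lemma ND_eq_if_ND_subset:
  assumes "compact Y" "Z \<subseteq> Y" "ND Y \<subseteq> Z"
  shows "ND Z = ND Y"
proof
  show "ND Y \<subseteq> ND Z"
    using assms(2,3) by (auto simp: ND_def)
  show "ND Z \<subseteq> ND Y"
  proof
    fix z assume z: "z \<in> ND Z"
    then have "z \<in> Y" using assms(2) by (auto simp: ND_def)
    then obtain y where "y \<in> ND Y" "dominates y z"
      using ND_externally_stable[OF assms(1)] by (auto simp: set_dominates_def)
    then show "z \<in> ND Y"
      using z assms(3) by (auto simp: ND_def)
  qed
qed

lemma weighted_less:
  fixes y z :: "real ^ 2"
  assumes "0 < lam" "lam < 1" "z $ 1 < y $ 1" "z $ 2 < y $ 2"
  shows "(1 - lam) * z $ 1 + lam * z $ 2 < (1 - lam) * y $ 1 + lam * y $ 2"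
  using assms by (intro add_strict_mono mult_strict_left_mono) auto

lemma UNIV_bound_index: "UNIV = {Obj 1, Obj 2, Lam}"
proof -
  have "i \<in> {Obj 1, Obj 2, Lam}" for i
    by (cases i) (use exhaust_2 in auto)
  then show ?thesis by blast
qed

text \<open>\<open>w\<close> stands for an arbitrary choice, index by index, between relaxed and
  mixed-integer special points, so that all choices of the index set are treated at once.\<close>

lemma ideal_points_dominate:
  fixes w :: "bound_index \<Rightarrow> real ^ 2"
  assumes lam: "0 < lam" "lam < 1"
    and obj: "\<And>k. w (Obj k) $ other k \<le> z $ other k"
    and weighted: "(1 - lam) * w Lam $ 1 + lam * w Lam $ 2 \<le> (1 - lam) * z $ 1 + lam * z $ 2"
  shows "\<exists>k. ideal_point (w ` (UNIV - {Obj k})) \<le> z"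
proof -
  have fin: "finite (w ` (UNIV - {Obj k}))" for k
    by (simp add: UNIV_bound_index)
  have le: "ideal_point (w ` (UNIV - {Obj k})) $ j \<le> w i $ j" if "i \<noteq> Obj k" for k i j
    using that by (intro ideal_point_le finite_imp_compact fin) auto
  consider "w Lam $ 2 \<le> z $ 2" | "w Lam $ 1 \<le> z $ 1"
    using weighted_less[OF lam, of z "w Lam"] weighted by fastforce
  then show ?thesis
  proof cases
    case 1
    \<comment> \<open>After removing \<open>Obj 1\<close>, coordinate 1 is controlled by
      \<open>Obj 2\<close>, which minimizes the first objective first, and coordinate 2 by
      \<open>Lam\<close>.\<close>
    have "ideal_point (w ` (UNIV - {Obj 1})) \<le> z"
      using le[of "Obj 2" 1 1] le[of Lam 1 2] obj[of 2] 1
      by (simp add: less_eq_vec_def forall_2)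
    then show ?thesis by blast
  next
    case 2
    have "ideal_point (w ` (UNIV - {Obj 2})) \<le> z"
      using le[of "Obj 1" 2 2] le[of Lam 2 1] obj[of 1] 2
      by (simp add: less_eq_vec_def forall_2)
    then show ?thesis by blast
  qed
qed

lemma mixed_bound_set_eq:
  "mixed_bound_set y yI I =
     (\<Union>k. {ideal_point ((\<lambda>i. if i \<in> I then yI i else y i) ` (UNIV - {Obj k}))})"
proof -
  have "{y i |i. i \<in> UNIV - {Obj k} \<and> i \<notin> I} \<union> {yI i |i. i \<in> I - {Obj k}} =
      (\<lambda>i. if i \<in> I then yI i else y i) ` (UNIV - {Obj k})" for k
    by auto
  then show ?thesis by (simp add: mixed_bound_set_def)
qed

text \<open>This makes rule (1a) the instance of rule (1b) with empty index set; \<open>yI\<close>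
  is arbitrary because the empty set never selects it.\<close>

lemma ideal_bound_set_eq: "ideal_bound_set y = mixed_bound_set y yI {}"
proof -
  have "{y (Obj i) |i. i \<noteq> k} \<union> {y Lam} = y ` (UNIV - {Obj k})" for k
    unfolding image_def by (auto, metis bound_index.exhaust)
  then show ?thesis by (simp add: mixed_bound_set_eq ideal_bound_set_def)
qed

lemma line_bound_set_dominates:
  assumes lam: "0 < lam" "lam < 1"
    and Y: "compact Y" "y \<in> Y"
    and min: "\<And>z. z \<in> Y \<Longrightarrow> (1 - lam) * y $ 1 + lam * y $ 2 \<le> (1 - lam) * z $ 1 + lam * z $ 2"
  shows "set_dominates (line_bound_set lam Y y) Y"
  unfolding set_dominates_def dominates_def
proof
  fix z assume z: "z \<in> Y"
  define q where "q = ideal_point Y"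
  define g where "g v = (1 - lam) * v $ 1 + lam * v $ 2" for v :: "real ^ 2"
  have q: "q $ k \<le> v $ k" if "v \<in> Y" for v k
    using ideal_point_le[OF Y(1) that] by (simp add: q_def)
  have "g q \<le> g y"
    unfolding g_def using q[OF Y(2)] lam by (intro add_mono mult_left_mono) auto
  moreover have "g y \<le> g z" using min[OF z] by (simp add: g_def)
  moreover have "continuous_on {0..1} (\<lambda>t. g (q + t *\<^sub>R (z - q)))"
    unfolding g_def by (intro continuous_intros)
  \<comment> \<open>At \<open>t = 0\<close> the value is \<open>g q\<close>, at most
    \<open>g y\<close>; at \<open>t = 1\<close> it is \<open>g z\<close>, at least
    \<open>g y\<close>.\<close>
  ultimately obtain t where t: "0 \<le> t" "t \<le> 1" "g (q + t *\<^sub>R (z - q)) = g y"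
    using IVT'[of "\<lambda>t. g (q + t *\<^sub>R (z - q))" 0 "g y" 1] by auto
  define v where "v = q + t *\<^sub>R (z - q)"
  have gv: "g v = g y" using t(3) by (simp only: v_def)
  have "q \<le> v"
    using q[OF z] t by (simp add: v_def less_eq_vec_def)
  moreover have "v \<le> z"
    unfolding less_eq_vec_def
  proof
    fix k
    have "t * (z $ k - q $ k) \<le> 1 * (z $ k - q $ k)"
      using q[OF z] t by (intro mult_right_mono) auto
    then show "v $ k \<le> z $ k" by (simp add: v_def)
  qed
  moreover have "v \<in> line_with_normal (weight_vec lam) y"
  proof -
    have "(1 - lam) * (v $ 1 - y $ 1) + lam * (v $ 2 - y $ 2) = g v - g y"
      by (simp add: g_def algebra_simps)
    then show ?thesis
      using gv
      by (simp add: line_with_normal_def orthogonal_def weight_vec_def inner_vec_def sum_2)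
  qed
  ultimately show "\<exists>v\<in>line_bound_set lam Y y. v \<le> z"
    by (intro bexI[of _ v]) (simp_all add: line_bound_set_def mem_plus_orthant_iff q_def)
qed

text \<open>With closedness, intersecting a polytope with the integrality constraints keeps it
  compact.\<close>

lemma closed_mixed_integer: "closed (mixed_integer J)"
proof -
  have "mixed_integer J = (\<Inter>i\<in>J. (\<lambda>x. x $ i) -` \<int>)"
    by (auto simp: mixed_integer_def)
  also have "closed \<dots>"
    by (intro closed_INT ballI continuous_closed_vimage closed_Ints) auto
  finally show ?thesis .
qed

lemma continuous_on_objective: "continuous_on S (objective c)"
  unfolding objective_def by (intro continuous_intros)

theorem proposition5:
  fixes A :: "real ^ 'd ^ 'm" and b :: "real ^ 'm" and l u :: "real ^ 'd"
    and J :: "'d set" and c :: "2 \<Rightarrow> real ^ 'd"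
    and X Xs XsI :: "(real ^ 'd) set" and f :: "real ^ 'd \<Rightarrow> real ^ 2"
    and Ys YsI L U :: "(real ^ 2) set"
    and T :: "('d \<Rightarrow> nat) set"
    and lam :: real and xbar xhat :: "real ^ 'd"
    and y yI :: "bound_index \<Rightarrow> real ^ 2"
  assumes X_def: "X = feasible_set A b l u"
    and f_def: "f = objective c"
    and bounds: "\<forall>i. l $ i < u $ i"
    and X_I_nonempty: "X \<inter> mixed_integer J \<noteq> {}"
    and Xs: "polytope Xs" "Xs \<subseteq> X"
    and XsI_def: "XsI = Xs \<inter> mixed_integer J"
    and XsI_nonempty: "XsI \<noteq> {}"
    and Ys_def: "Ys = f ` Xs"
    and YsI_def: "YsI = f ` XsI"
    and L_def: "L = ND Ys + nonneg_orthant"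
    and T: "finite T" "T \<subseteq> J \<rightarrow>\<^sub>E UNIV" "\<forall>t\<in>T. fibre X J t \<noteq> {}"
    and U_def: "U = primal_points f X J T + nonneg_orthant"
    and y_def: "y = special_point f Xs xbar"
    and yI_def: "yI = special_point f XsI xhat"
    and y_neq: "y (Obj 1) \<noteq> y (Obj 2)"
    and lam: "0 < lam" "lam < 1"
      "normal_vector_of (weight_vec lam) (closed_segment (y (Obj 1)) (y (Obj 2)))"
    and xbar: "is_arg_min (weighted_objective f lam) (\<lambda>x. x \<in> Xs) xbar"
    and xhat: "is_arg_min (weighted_objective f lam) (\<lambda>x. x \<in> XsI) xhat"
  shows "(ND Ys \<subseteq> YsI \<longrightarrow> ND YsI = ND Ys) \<and>
    (set_dominates U (ideal_bound_set y) \<longrightarrow> set_dominates U YsI) \<and>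
    (set_dominates U (line_bound_set lam Ys (y Lam)) \<longrightarrow> set_dominates U YsI) \<and>
    ((\<exists>I. set_dominates U (mixed_bound_set y yI I)) \<longrightarrow> set_dominates U YsI) \<and>
    (set_dominates U (line_bound_set lam YsI (yI Lam)) \<longrightarrow> set_dominates U YsI) \<and>
    (L \<subseteq> U \<longrightarrow> set_dominates U YsI)"
proof -
  have comp: "compact Xs" "compact XsI"
    using Xs(1) by (simp_all add: XsI_def polytope_imp_compact compact_Int_closed closed_mixed_integer)
  then have compY: "compact Ys" "compact YsI"
    unfolding Ys_def YsI_def f_def
    by (auto intro: compact_continuous_image continuous_on_objective)
  have sub: "YsI \<subseteq> Ys" by (auto simp: Ys_def YsI_def XsI_def)
  have barI: "xbar \<in> Xs" "\<And>x. x \<in> Xs \<Longrightarrow> weighted_objective f lam xbar \<le> weighted_objective f lam x"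
    using xbar by (force simp: is_arg_min_def not_less)+
  have hatI: "xhat \<in> XsI" "\<And>x. x \<in> XsI \<Longrightarrow> weighted_objective f lam xhat \<le> weighted_objective f lam x"
    using xhat by (force simp: is_arg_min_def not_less)+
  have mixed: "set_dominates (mixed_bound_set y yI I) YsI" for I
    unfolding set_dominates_def dominates_def
  proof
    fix z assume "z \<in> YsI"
    then obtain x where x: "x \<in> XsI" "z = f x" by (auto simp: YsI_def)
    then have xs: "x \<in> Xs" by (simp add: XsI_def)
    let ?w = "\<lambda>i. if i \<in> I then yI i else y i"
    \<comment> \<open>As \<open>x\<close> lies in both \<open>Xs\<close> and \<open>XsI\<close>,
      minima over either set bound its values from below, whichever of the two \<open>?w\<close>
      selects.\<close>
    have "?w (Obj k) $ other k \<le> z $ other k" for k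
      using lex_min_other_le[of f Xs x k] lex_min_other_le[of f XsI x k] compY x xs
      by (simp add: y_def yI_def special_point_def Ys_def YsI_def)
    moreover have "(1 - lam) * ?w Lam $ 1 + lam * ?w Lam $ 2 \<le> (1 - lam) * z $ 1 + lam * z $ 2"
      using barI(2)[OF xs] hatI(2)[OF x(1)] x(2)
      by (simp add: y_def yI_def special_point_def weighted_objective_def)
    ultimately obtain k where "ideal_point (?w ` (UNIV - {Obj k})) \<le> z"
      using ideal_points_dominate[OF lam(1,2), of ?w z] by blast
    then show "\<exists>v\<in>mixed_bound_set y yI I. v \<le> z"
      unfolding mixed_bound_set_eq by blast
  qed
  have line: "set_dominates (line_bound_set lam Ys (y Lam)) Ys"
    using barI unfolding y_def special_point_def Ys_def
    by (intro line_bound_set_dominates lam(1,2) compY(1)[unfolded Ys_def])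
      (auto simp: weighted_objective_def)
  have lineI: "set_dominates (line_bound_set lam YsI (yI Lam)) YsI"
    using hatI unfolding yI_def special_point_def YsI_def
    by (intro line_bound_set_dominates lam(1,2) compY(2)[unfolded YsI_def])
      (auto simp: weighted_objective_def)
  have relaxed: "set_dominates U YsI" if "set_dominates U Ys"
    using that sub by (auto simp: set_dominates_def)
  \<comment> \<open>For rule (3): external stability places every relaxed image point in
    \<open>L\<close>. If \<open>L\<close> is contained in \<open>U\<close>, each such point is
    dominated by itself as an element of \<open>U\<close>.\<close>
  have "Ys \<subseteq> L"
    using ND_externally_stable[OF compY(1)]
    by (auto simp: L_def mem_plus_orthant_iff set_dominates_def dominates_def)
  then have "set_dominates U Ys" if "L \<subseteq> U"
    using that by (auto simp: set_dominates_def dominates_def)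
  then show ?thesis
    by (intro conjI impI; (elim exE)?)
      (simp_all add: ND_eq_if_ND_subset[OF compY(1) sub] relaxed ideal_bound_set_eq[of y yI]
        set_dominates_trans[OF _ mixed] set_dominates_trans[OF _ line]
        set_dominates_trans[OF _ lineI])
qed

end
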